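(* Let $\mathcal I$ be a multinomial or a fixed-mean Gaussian inference family (as in the context) associated with a connected factor graph $H$. Then the Bethe free energy $F_{\mathrm B}$ is convex on $L(\mathcal I)$ if and only if the nullity $n(H)$ equals $0$ or $1$.
   Context: A hypergraph (factor graph) $H=(V,F)$: finite $V$, finite collection $F$ of nonempty subsets; $d_i=|\{\alpha:i\in\alpha\}|$; $\vec E=\{(\alpha\to i):i\in\alpha\}$. Its nullity is $n(H)=|\vec E|-|V|-|F|+k(H)$, $k(H)$ the number of connected components (equivalently the nullity of the bipartite graph on $V\cup F$ with an edge $\{i,\alpha\}$ for each $i\in\alpha$). Multinomial family: each $\mathcal X_i=\{1,\dots,N_i\}$ finite; $L$ is the set of families of strictly positive probability functions $b_\alpha$ on $\prod_{i\in\alpha}\mathcal X_i$ and $b_i$ on $\mathcal X_i$ with $b_i$ the $x_i$-marginal of $b_\alpha$; for given positive $\Psi_\alpha$, $F_{\mathrm B}=-\sum_\alpha\sum_{x_\alpha} b_\alpha\log\Psi_\alpha+\sum_\alpha\sum_{x_\alpha} b_\alpha\log b_\alpha+\sum_i(1-d_i)\sum_{x_i} b_i\log b_i$. Fixed-mean Gaussian family: $H$ is a simple graph $G=(V,E)$ with edges as factors; $L=\{(\eta_{ii})_{i},(\eta_{ij})_{ij\in E}:\eta_{ii}>0,\ \eta_{ii}\eta_{jj}-\eta_{ij}^2>0\}$ and $F_{\mathrm B}(\eta)=\ell(\eta)-\tfrac12\sum_{ij\in E}\log(\eta_{ii}\eta_{jj}-\eta_{ij}^2)-\tfrac12\sum_i(1-d_i)\log\eta_{ii}$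 up to an additive constant, with $\ell$ a linear function (the negative-entropy form of the Bethe free energy for Gaussians with fixed mean and second moments $\eta$).
   Formalization: In the multinomial case every variable is assumed to have at least two states (N_i ≥ 2); with one-point state spaces the claim fails, e.g. if all N_i = 1 then L is a single point and F_B is convex whatever the nullity. *)

theory Defs
  imports "HOL-Analysis.Analysis" "HOL-Library.Function_Algebras"
begin

text \<open>
  Pointwise real vector space structure on functions, so that the library notions
  \<open>convex_on\<close> and \<open>linear\<close> apply to families of real numbers over arbitrary index sets.
\<close>

instantiation "fun" :: (type, real_vector) real_vector
begin

definition scaleR_fun :: "real \<Rightarrow> ('a \<Rightarrow> 'b) \<Rightarrow> 'a \<Rightarrow> 'b"
  where "scaleR_fun c f = (\<lambda>x. c *\<^sub>R f x)"

instance
  by standard (simp_all add: fun_eq_iff scaleR_fun_def algebra_simps)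

end


section \<open>Hypergraphs\<close>

definition hypergraph :: "'v set \<Rightarrow> 'v set set \<Rightarrow> bool"
  where "hypergraph V F \<longleftrightarrow> finite V \<and> (\<forall>\<alpha>\<in>F. \<alpha> \<noteq> {} \<and> \<alpha> \<subseteq> V)"

definition simple_graph :: "'v set \<Rightarrow> 'v set set \<Rightarrow> bool"
  where "simple_graph V E \<longleftrightarrow> hypergraph V E \<and> (\<forall>e\<in>E. card e = 2)"

definition hdegree :: "'v set set \<Rightarrow> 'v \<Rightarrow> nat"
  where "hdegree F i = card {\<alpha>\<in>F. i \<in> \<alpha>}"

definition directed_edges :: "'v set set \<Rightarrow> ('v set \<times> 'v) set"
  where "directed_edges F = {(\<alpha>, i). \<alpha> \<in> F \<and> i \<in> \<alpha>}"

text \<open>Connectivity is that of the bipartite graph with vertex set \<open>V <+> F\<close>.\<close>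

definition incidence :: "'v set set \<Rightarrow> ('v + 'v set) rel"
  where "incidence F = {(Inl i, Inr \<alpha>) | i \<alpha>. \<alpha> \<in> F \<and> i \<in> \<alpha>}"

definition joined :: "'v set set \<Rightarrow> ('v + 'v set) rel"
  where "joined F = (incidence F \<union> (incidence F)\<inverse>)\<^sup>*"

definition num_components :: "'v set \<Rightarrow> 'v set set \<Rightarrow> nat"
  where "num_components V F = card ((V <+> F) // joined F)"

definition hconnected :: "'v set \<Rightarrow> 'v set set \<Rightarrow> bool"
  where "hconnected V F \<longleftrightarrow> V \<noteq> {} \<and> (\<forall>a \<in> V <+> F. \<forall>b \<in> V <+> F. (a, b) \<in> joined F)"

definition nullity :: "'v set \<Rightarrow> 'v set set \<Rightarrow> int"
  where "nullity V F =
    int (card (directed_edges F)) - int (card V) - int (card F) + int (num_components V F)"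


section \<open>Multinomial inference families\<close>

definition states :: "('v \<Rightarrow> nat) \<Rightarrow> 'v \<Rightarrow> nat set"
  where "states N i = {1..N i}"

definition configs :: "('v \<Rightarrow> nat) \<Rightarrow> 'v set \<Rightarrow> ('v \<Rightarrow> nat) set"
  where "configs N \<alpha> = (\<Pi>\<^sub>E i\<in>\<alpha>. states N i)"

type_synonym 'v beliefs = "('v set \<Rightarrow> ('v \<Rightarrow> nat) \<Rightarrow> real) \<times> ('v \<Rightarrow> nat \<Rightarrow> real)"

definition pos_prob_fun :: "'x set \<Rightarrow> ('x \<Rightarrow> real) \<Rightarrow> bool"
  where "pos_prob_fun X p \<longleftrightarrow> (\<forall>x\<in>X. p x > 0) \<and> (\<Sum>x\<in>X. p x) = 1"

text \<open>
  A pair \<open>(bF, bV)\<close> consists of the factor beliefs \<open>b\<^sub>\<alpha>\<close> and the variable beliefs \<open>b\<^sub>i\<close>.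
  The last two conditions normalise the values at arguments which are not part of the data
  to \<open>0\<close>, so that elements of the set correspond bijectively to families of beliefs.
\<close>

definition multinomial_L :: "'v set \<Rightarrow> 'v set set \<Rightarrow> ('v \<Rightarrow> nat) \<Rightarrow> 'v beliefs set"
  where "multinomial_L V F N = {(bF, bV).
    (\<forall>\<alpha>\<in>F. pos_prob_fun (configs N \<alpha>) (bF \<alpha>)) \<and>
    (\<forall>i\<in>V. pos_prob_fun (states N i) (bV i)) \<and>
    (\<forall>\<alpha>\<in>F. \<forall>i\<in>\<alpha>. \<forall>a\<in>states N i. bV i a = (\<Sum>x\<in>{x\<in>configs N \<alpha>. x i = a}. bF \<alpha> x)) \<and>
    (\<forall>\<alpha> x. \<not> (\<alpha> \<in> F \<and> x \<in> configs N \<alpha>) \<longrightarrow> bF \<alpha> x = 0) \<and>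
    (\<forall>i a. \<not> (i \<in> V \<and> a \<in> states N i) \<longrightarrow> bV i a = 0)}"

definition multinomial_FB ::
  "'v set \<Rightarrow> 'v set set \<Rightarrow> ('v \<Rightarrow> nat) \<Rightarrow> ('v set \<Rightarrow> ('v \<Rightarrow> nat) \<Rightarrow> real) \<Rightarrow> 'v beliefs \<Rightarrow> real"
  where "multinomial_FB V F N \<Psi> = (\<lambda>(bF, bV).
      - (\<Sum>\<alpha>\<in>F. \<Sum>x\<in>configs N \<alpha>. bF \<alpha> x * ln (\<Psi> \<alpha> x))
      + (\<Sum>\<alpha>\<in>F. \<Sum>x\<in>configs N \<alpha>. bF \<alpha> x * ln (bF \<alpha> x))
      + (\<Sum>i\<in>V. (1 - real (hdegree F i)) * (\<Sum>a\<in>states N i. bV i a * ln (bV i a))))"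

text \<open>
  \<open>N i \<ge> 2\<close> excludes one-point state spaces, on which the multinomial family is
  zero-dimensional (if all \<open>N i = 1\<close>, the domain is a single point).
\<close>

definition multinomial_data ::
  "'v set \<Rightarrow> 'v set set \<Rightarrow> ('v \<Rightarrow> nat) \<Rightarrow> ('v set \<Rightarrow> ('v \<Rightarrow> nat) \<Rightarrow> real) \<Rightarrow> bool"
  where "multinomial_data V F N \<Psi> \<longleftrightarrow>
    (\<forall>i\<in>V. N i \<ge> 2) \<and> (\<forall>\<alpha>\<in>F. \<forall>x\<in>configs N \<alpha>. \<Psi> \<alpha> x > 0)"


section \<open>Fixed-mean Gaussian inference families\<close>

text \<open>
  A pair \<open>(\<eta>V, \<eta>E)\<close> stands for the second moments: \<open>\<eta>V i\<close> is \<open>\<eta>\<^sub>i\<^sub>i\<close> and \<open>\<eta>E {i, j}\<close> is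
  \<open>\<eta>\<^sub>i\<^sub>j\<close>. For an edge \<open>e = {i, j}\<close> the product of \<open>\<eta>V\<close> over \<open>e\<close> is \<open>\<eta>\<^sub>i\<^sub>i \<eta>\<^sub>j\<^sub>j\<close>.
\<close>

type_synonym 'v moments = "('v \<Rightarrow> real) \<times> ('v set \<Rightarrow> real)"

definition edge_det :: "'v moments \<Rightarrow> 'v set \<Rightarrow> real"
  where "edge_det \<eta> e = (\<Prod>i\<in>e. fst \<eta> i) - (snd \<eta> e)\<^sup>2"

definition gaussian_L :: "'v set \<Rightarrow> 'v set set \<Rightarrow> 'v moments set"
  where "gaussian_L V E = {(\<eta>V, \<eta>E).
    (\<forall>i\<in>V. \<eta>V i > 0) \<and> (\<forall>e\<in>E. edge_det (\<eta>V, \<eta>E) e > 0) \<and>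
    (\<forall>i. i \<notin> V \<longrightarrow> \<eta>V i = 0) \<and> (\<forall>e. e \<notin> E \<longrightarrow> \<eta>E e = 0)}"

definition gaussian_FB ::
  "'v set \<Rightarrow> 'v set set \<Rightarrow> ('v moments \<Rightarrow> real) \<Rightarrow> real \<Rightarrow> 'v moments \<Rightarrow> real"
  where "gaussian_FB V E l c \<eta> =
      l \<eta> - 1/2 * (\<Sum>e\<in>E. ln (edge_det \<eta> e))
      - 1/2 * (\<Sum>i\<in>V. (1 - real (hdegree E i)) * ln (fst \<eta> i)) + c"

end

theory Submission
  imports Defs
begin

text \<open>
  If \<open>n(H) \<le> 1\<close>, the bipartite incidence graph is a tree or unicyclic, so its edges can be assigned
  injectively to their end points. Read on the factors, this is a choice of one \<open>c(\<alpha>) \<in> \<alpha>\<close> per factor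
  such that every variable \<open>i\<close> is chosen at least \<open>d\<^sub>i - 1\<close> times. Then the free energy is a sum of
  conditional negative entropies of \<open>b\<^sub>\<alpha>\<close> given \<open>b\<^sub>c\<^sub>(\<^sub>\<alpha>\<^sub>)\<close> and of nonnegative multiples of negative
  entropies of the \<open>b\<^sub>i\<close>, each of which is convex.

  If \<open>n(H) \<ge> 2\<close>, convexity fails near perfectly correlated beliefs: there every factor has the
  entropy of a single variable, and the free energy degenerates to \<open>n(H) - 1\<close> times a strictly
  concave function of one parameter.
\<close>

section \<open>Orientations of unicyclic graphs\<close>

text \<open>Breadth-first tree: each vertex other than \<open>r\<close> is given an edge to a
  neighbour strictly closer to \<open>r\<close>. Following these edges decreases the distance, so
  they already connect everything to \<open>r\<close>.\<close>

lemma spanning_tree_edges: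
  fixes R :: "'w rel"
  assumes W: "r \<in> W" "Field R \<subseteq> W" and conn: "\<And>w. w \<in> W \<Longrightarrow> (w, r) \<in> (R \<union> R\<inverse>)\<^sup>*"
  obtains p :: "'w \<Rightarrow> 'w \<times> 'w" where "inj_on p (W - {r})"
    and "\<And>v. v \<in> W - {r} \<Longrightarrow> p v \<in> R \<and> v \<in> {fst (p v), snd (p v)}"
    and "\<And>w. w \<in> W \<Longrightarrow> (w, r) \<in> (p ` (W - {r}) \<union> (p ` (W - {r}))\<inverse>)\<^sup>*"
proof -
  define S where "S = R \<union> R\<inverse>"
  define d where "d w = (LEAST n. (w, r) \<in> S ^^ n)" for w
  have dist: "(w, r) \<in> S ^^ d w" if "w \<in> W" for w
    using LeastI_ex[of "\<lambda>n. (w, r) \<in> S ^^ n"] conn[OF that] unfolding d_def S_def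
    by (metis rtrancl_imp_relpow)
  have "\<exists>u. (w, u) \<in> S \<and> d u < d w" if w: "w \<in> W - {r}" for w
  proof (cases "d w")
    case 0
    then show ?thesis using dist[of w] w by simp
  next
    case (Suc m)
    then obtain u where "(w, u) \<in> S" "(u, r) \<in> S ^^ m"
      using dist[of w] w relpow_Suc_D2 by (metis DiffD1)
    moreover from this have "d u \<le> m"
      unfolding d_def by (intro Least_le)
    ultimately show ?thesis using Suc by auto
  qed
  then obtain q where q: "\<And>w. w \<in> W - {r} \<Longrightarrow> (w, q w) \<in> S \<and> d (q w) < d w" by metis
  \<comment> \<open>\<open>q w\<close> is a neighbour in the symmetric closure only, so the pair is
    turned to the direction that lies in \<open>R\<close>.\<close>
  define p where "p w = (if (w, q w) \<in> R then (w, q w) else (q w, w))" for w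
  have ends: "{fst (p w), snd (p w)} = {w, q w}" for w
    by (auto simp: p_def)
  have qW: "q w \<in> W" if "w \<in> W - {r}" for w
    using q[OF that] W(2) unfolding S_def by (auto simp: Field_def)
  show thesis
  proof
    show "inj_on p (W - {r})"
    proof (rule inj_onI)
      fix v w assume v: "v \<in> W - {r}" and w: "w \<in> W - {r}" and "p v = p w"
      then have "{v, q v} = {w, q w}" using ends by metis
      \<comment> \<open>Otherwise \<open>q v = w\<close> and \<open>q w = v\<close>, and each of the
        two would be strictly closer to \<open>r\<close> than the other.\<close>
      then show "v = w" using q[OF v] q[OF w] by (auto simp: doubleton_eq_iff)
    qed
    show "p v \<in> R \<and> v \<in> {fst (p v), snd (p v)}" if "v \<in> W - {r}" for v
      using q[OF that] by (auto simp: p_def S_def)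
    show "(w, r) \<in> (p ` (W - {r}) \<union> (p ` (W - {r}))\<inverse>)\<^sup>*" if "w \<in> W" for w
      using that
    proof (induction "d w" arbitrary: w rule: less_induct)
      case less
      show ?case
      proof (cases "w = r")
        case False
        with less.prems have w: "w \<in> W - {r}" by simp
        then have "p w \<in> p ` (W - {r})" by blast
        then have "(w, q w) \<in> p ` (W - {r}) \<union> (p ` (W - {r}))\<inverse>"
          by (auto simp: p_def split: if_splits)
        moreover note less.hyps[of "q w"] q[OF w] qW[OF w]
        ultimately show ?thesis by (meson converse_rtrancl_into_rtrancl)
      qed simp
    qed
  qed
qed

lemma card_edges_connected:
  fixes R :: "'w rel"
  assumes "finite W" "finite R" "Field R \<subseteq> W" "\<And>v w. v \<in> W \<Longrightarrow> w \<in> W \<Longrightarrow> (v, w) \<in> (R \<union> R\<inverse>)\<^sup>*"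
  shows "card W \<le> card R + 1"
proof (cases "W = {}")
  case False
  then obtain r where r: "r \<in> W" by blast
  obtain p where "inj_on p (W - {r})" "\<And>v. v \<in> W - {r} \<Longrightarrow> p v \<in> R \<and> v \<in> {fst (p v), snd (p v)}"
    using spanning_tree_edges[of r W R] r assms(3,4) by metis
  then have "card (W - {r}) \<le> card R"
    by (intro card_inj_on_le[of p]) (use assms(2) in blast)+
  then show ?thesis using r assms(1) by simp
qed simp

text \<open>A non-tree edge is given to the root of a spanning tree which starts at one of its ends.\<close>

lemma unicyclic_orientation:
  fixes R :: "'w rel"
  assumes fin: "finite W" "finite R" and R: "Field R \<subseteq> W"
    and conn: "\<And>v w. v \<in> W \<Longrightarrow> w \<in> W \<Longrightarrow> (v, w) \<in> (R \<union> R\<inverse>)\<^sup>*" and card: "card R \<le> card W"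
  obtains g where "inj_on g R" "\<And>e. e \<in> R \<Longrightarrow> g e \<in> {fst e, snd e}"
proof (cases "W = {}")
  case True
  then have "R = {}" using R by (auto simp: Field_def)
  then show thesis using that[of fst] by simp
next
  case False
  then obtain r where r: "r \<in> W" by blast
  obtain p where p: "inj_on p (W - {r})"
      "\<And>v. v \<in> W - {r} \<Longrightarrow> p v \<in> R \<and> v \<in> {fst (p v), snd (p v)}"
      "\<And>w. w \<in> W \<Longrightarrow> (w, r) \<in> (p ` (W - {r}) \<union> (p ` (W - {r}))\<inverse>)\<^sup>*"
    using spanning_tree_edges[of r W R] r R conn by metis
  define T where "T = p ` (W - {r})"
  have T: "T \<subseteq> R" "card T = card W - 1"
    unfolding T_def using p(2) r by (blast, simp add: card_image[OF p(1)])
  show thesis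
  proof (cases "T = R")
    case True
    \<comment> \<open>Each tree edge goes to the vertex that selected it; the root receives
      none.\<close>
    define g where "g = the_inv_into (W - {r}) p"
    have gp: "g (p v) = v" if "v \<in> W - {r}" for v
      unfolding g_def using the_inv_into_f_f[OF p(1) that] .
    have "inj_on g T" "\<And>e. e \<in> T \<Longrightarrow> g e \<in> {fst e, snd e}"
      unfolding T_def inj_on_def using p(2) gp by (metis (full_types) imageE)+
    then show thesis using that True by blast
  next
    case False
    then obtain a b where e: "(a, b) \<in> R - T" using T(1) by auto
    \<comment> \<open>The tree is re-rooted at the end \<open>a\<close> of the extra edge: the edges
      of \<open>T\<close> are then used up by the vertices other than \<open>a\<close>, which leaves
      \<open>a\<close> free for \<open>(a, b)\<close>.\<close>
    have aW: "a \<in> W" using e R by (auto simp: Field_def)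
    have sym: "sym ((T \<union> T\<inverse>)\<^sup>*)" by (intro sym_rtrancl sym_Un_converse)
    have "(w, a) \<in> (T \<union> T\<inverse>)\<^sup>*" if "w \<in> W" for w
      using p(3)[OF that] symD[OF sym, OF p(3)[OF aW, folded T_def]]
      unfolding T_def by (meson rtrancl_trans)
    moreover have "Field T \<subseteq> W" using T(1) R by (auto simp: Field_def)
    ultimately obtain q where q: "inj_on q (W - {a})"
        "\<And>v. v \<in> W - {a} \<Longrightarrow> q v \<in> T \<and> v \<in> {fst (q v), snd (q v)}"
      using spanning_tree_edges[of a W T] aW by metis
    have finT: "finite T" using T(1) fin(2) finite_subset by blast
    have qT: "q ` (W - {a}) = T"
    proof (rule card_subset_eq[OF finT])
      show "q ` (W - {a}) \<subseteq> T" using q(2) by blast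
      show "card (q ` (W - {a})) = card T" using T(2) aW by (simp add: card_image[OF q(1)])
    qed
    \<comment> \<open>One extra edge exhausts the bound on \<open>card R\<close>, so no further edge
      has to be oriented.\<close>
    have "card (insert (a, b) T) = card W"
      using e finT T(2) r fin(1) by (simp add: card_gt_0_iff) (metis Suc_pred card_gt_0_iff empty_iff)
    then have RT: "R = insert (a, b) T"
      using card_seteq[OF fin(2), of "insert (a, b) T"] e T(1) card by auto
    define g where "g = (\<lambda>e. if e = (a, b) then a else the_inv_into (W - {a}) q e)"
    have gq: "g (q v) = v" if "v \<in> W - {a}" for v
      using that the_inv_into_f_f[OF q(1) that] q(2)[OF that] e unfolding g_def by auto
    have ga: "g (a, b) = a" by (simp add: g_def)
    have gT: "\<exists>v \<in> W - {a}. e = q v \<and> g e = v \<and> v \<in> {fst e, snd e}" if "e \<in> T" for e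
      using that gq q(2) unfolding qT[symmetric] by blast
    show thesis
    proof
      show "inj_on g R"
        unfolding RT inj_on_def using gT ga by (metis DiffE insertE singletonI)
      show "g e \<in> {fst e, snd e}" if "e \<in> R" for e
        using that gT[of e] ga unfolding RT by auto
    qed
  qed
qed

section \<open>Incidence graphs of hypergraphs\<close>

lemma finite_factors: "hypergraph V F \<Longrightarrow> finite F"
  unfolding hypergraph_def by (meson PowI finite_Pow_iff finite_subset subsetI)

text \<open>Double counting by variables; it evaluates the sum of the coefficients
  \<open>1 - d_i\<close> at the test points.\<close>

lemma card_directed_edges_eq_sum_hdegree:
  assumes "hypergraph V F"
  shows "card (directed_edges F) = (\<Sum>i\<in>V. hdegree F i)"
proof -
  have V: "finite V" "finite F" using assms finite_factors by (auto simp: hypergraph_def)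
  have "bij_betw prod.swap (directed_edges F) (Sigma V (\<lambda>i. {\<alpha>\<in>F. i \<in> \<alpha>}))"
    using assms by (intro bij_betwI[of _ _ _ prod.swap]) (auto 4 4 simp: directed_edges_def hypergraph_def)
  then have "card (directed_edges F) = card (Sigma V (\<lambda>i. {\<alpha>\<in>F. i \<in> \<alpha>}))"
    by (rule bij_betw_same_card)
  also have "\<dots> = (\<Sum>i\<in>V. hdegree F i)"
    using V by (simp add: hdegree_def)
  finally show ?thesis .
qed

lemma card_directed_edges_eq_sum_card:
  assumes "hypergraph V F"
  shows "card (directed_edges F) = (\<Sum>\<alpha>\<in>F. card \<alpha>)"
proof -
  have "directed_edges F = Sigma F (\<lambda>\<alpha>. \<alpha>)" by (auto simp: directed_edges_def)
  moreover have "finite \<alpha>" if "\<alpha> \<in> F" for \<alpha>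
    using that assms by (auto simp: hypergraph_def intro: finite_subset)
  ultimately show ?thesis using finite_factors[OF assms] by simp
qed

lemma card_incidence: "card (incidence F) = card (directed_edges F)"
proof -
  have "bij_betw (\<lambda>(\<alpha>, i). (Inl i, Inr \<alpha>)) (directed_edges F) (incidence F)"
    by (auto simp: bij_betw_def inj_on_def directed_edges_def incidence_def image_def)
  then show ?thesis by (simp add: bij_betw_same_card)
qed

lemma num_components_connected:
  assumes "hconnected V F"
  shows "num_components V F = 1"
proof -
  obtain v where v: "v \<in> V" using assms by (auto simp: hconnected_def)
  have tr: "trans (joined F)" unfolding joined_def by (rule trans_rtrancl)
  have "joined F `` {x} = joined F `` {Inl v}" if "x \<in> V <+> F" for x
  proof -
    have "(x, Inl v) \<in> joined F" "(Inl v, x) \<in> joined F"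
      using that v assms unfolding hconnected_def by blast+
    then show ?thesis using tr by (blast dest: transD)
  qed
  then have "(V <+> F) // joined F = {joined F `` {Inl v}}"
    using v by (auto simp: quotient_def)
  then show ?thesis by (simp add: num_components_def)
qed

lemma nullity_connected:
  assumes "hconnected V F"
  shows "nullity V F = int (card (directed_edges F)) - int (card V) - int (card F) + 1"
  using num_components_connected[OF assms] by (simp add: nullity_def)

section \<open>Connected hypergraphs: sign of the nullity and choice of variables\<close>

context
  fixes V :: "'v set" and F :: "'v set set"
  assumes H: "hypergraph V F" "hconnected V F"
begin

private lemma incidence_graph:
  "finite (V <+> F)" "finite (incidence F)" "Field (incidence F) \<subseteq> V <+> F"
  "v \<in> V <+> F \<Longrightarrow> w \<in> V <+> F \<Longrightarrow> (v, w) \<in> (incidence F \<union> (incidence F)\<inverse>)\<^sup>*"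
  "card (V <+> F) = card V + card F"
proof -
  have fin: "finite V" "finite F" using H finite_factors by (auto simp: hypergraph_def)
  then show "finite (V <+> F)" "card (V <+> F) = card V + card F"
    by (simp_all add: card_Plus)
  show F: "Field (incidence F) \<subseteq> V <+> F"
    using H(1) by (auto simp: incidence_def Field_def hypergraph_def)
  have "incidence F \<subseteq> (V <+> F) \<times> (V <+> F)"
    using F by (auto simp: Field_def)
  then show "finite (incidence F)"
    using \<open>finite (V <+> F)\<close> by (meson finite_SigmaI finite_subset)
  show "v \<in> V <+> F \<Longrightarrow> w \<in> V <+> F \<Longrightarrow> (v, w) \<in> (incidence F \<union> (incidence F)\<inverse>)\<^sup>*"
    using H(2) by (simp add: hconnected_def joined_def)
qed

lemma nullity_nonneg: "nullity V F \<ge> 0"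
  using card_edges_connected[OF incidence_graph(1-4)] nullity_connected[OF H(2)]
  by (simp add: card_incidence incidence_graph(5))

text \<open>Each factor gives away its entropy to one variable, covering the multiplicities \<open>d\<^sub>i - 1\<close>.\<close>

lemma factor_choice:
  assumes "nullity V F \<le> 1"
  obtains c where "\<And>\<alpha>. \<alpha> \<in> F \<Longrightarrow> c \<alpha> \<in> \<alpha>"
    and "\<And>i. i \<in> V \<Longrightarrow> hdegree F i \<le> card {\<alpha>\<in>F. c \<alpha> = i} + 1"
proof -
  \<comment> \<open>With a single component, nullity at most 1 means that the bipartite graph has no
    more edges than vertices.\<close>
  have "card (incidence F) \<le> card (V <+> F)"
    using assms nullity_connected[OF H(2)] by (simp add: card_incidence incidence_graph(5))
  then obtain g where inj: "inj_on g (incidence F)"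
    and g: "\<And>e. e \<in> incidence F \<Longrightarrow> g e \<in> {fst e, snd e}"
    using unicyclic_orientation[OF incidence_graph(1-4)] by blast
  \<comment> \<open>Injectivity of \<open>g\<close> lets at most one edge at \<alpha> be assigned to
    \<alpha> itself. Its variable is chosen if there is one, and an arbitrary element of \<alpha>
    otherwise.\<close>
  define c where "c \<alpha> = (if \<exists>i\<in>\<alpha>. g (Inl i, Inr \<alpha>) = Inr \<alpha>
      then SOME i. i \<in> \<alpha> \<and> g (Inl i, Inr \<alpha>) = Inr \<alpha> else SOME i. i \<in> \<alpha>)" for \<alpha>
  have inc: "(Inl i, Inr \<alpha>) \<in> incidence F" if "\<alpha> \<in> F" "i \<in> \<alpha>" for i \<alpha>
    using that by (auto simp: incidence_def)
  have c: "c \<alpha> \<in> \<alpha>" "\<exists>i\<in>\<alpha>. g (Inl i, Inr \<alpha>) = Inr \<alpha> \<Longrightarrow> g (Inl (c \<alpha>), Inr \<alpha>) = Inr \<alpha>"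
    if "\<alpha> \<in> F" for \<alpha>
  proof -
    have "\<alpha> \<noteq> {}" using that H(1) by (auto simp: hypergraph_def)
    then show "c \<alpha> \<in> \<alpha>"
      unfolding c_def by (auto intro: someI2 some_in_eq[THEN iffD2])
    show "g (Inl (c \<alpha>), Inr \<alpha>) = Inr \<alpha>" if "\<exists>i\<in>\<alpha>. g (Inl i, Inr \<alpha>) = Inr \<alpha>"
      using that unfolding c_def by (auto intro: someI2)
  qed
  have fin: "finite F" using H finite_factors by blast
  show thesis
  proof
    fix i assume "i \<in> V"
    \<comment> \<open>An edge at \<open>i\<close> whose factor does not choose \<open>i\<close> is
      assigned to \<open>i\<close>. Injectivity then allows at most one such factor, which is the
      \<open>+ 1\<close> in the bound.\<close>
    have *: "g (Inl i, Inr \<alpha>) = Inl i" if "\<alpha> \<in> F" "i \<in> \<alpha>" "c \<alpha> \<noteq> i" for \<alpha>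
    proof (rule ccontr)
      assume "g (Inl i, Inr \<alpha>) \<noteq> Inl i"
      then have "g (Inl i, Inr \<alpha>) = Inr \<alpha>" using g[OF inc[OF that(1,2)]] by simp
      moreover from this have "g (Inl (c \<alpha>), Inr \<alpha>) = Inr \<alpha>" using c(2) that by blast
      ultimately show False
        using inj_onD[OF inj, of "(Inl i, Inr \<alpha>)" "(Inl (c \<alpha>), Inr \<alpha>)"]
          inc[OF that(1)] that c(1)[OF that(1)] by auto
    qed
    have "card {\<alpha>\<in>F. i \<in> \<alpha> \<and> c \<alpha> \<noteq> i} \<le> 1"
    proof (rule card_le_Suc0_iff_eq[THEN iffD2, unfolded One_nat_def[symmetric]])
      show "finite {\<alpha>\<in>F. i \<in> \<alpha> \<and> c \<alpha> \<noteq> i}" using fin by simp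
      show "\<forall>\<alpha>\<in>{\<alpha>\<in>F. i \<in> \<alpha> \<and> c \<alpha> \<noteq> i}. \<forall>\<beta>\<in>{\<alpha>\<in>F. i \<in> \<alpha> \<and> c \<alpha> \<noteq> i}. \<alpha> = \<beta>"
      proof (intro ballI)
        fix \<alpha> \<beta> assume "\<alpha> \<in> {\<alpha>\<in>F. i \<in> \<alpha> \<and> c \<alpha> \<noteq> i}" "\<beta> \<in> {\<alpha>\<in>F. i \<in> \<alpha> \<and> c \<alpha> \<noteq> i}"
        then show "\<alpha> = \<beta>"
          using inj_onD[OF inj, of "(Inl i, Inr \<alpha>)" "(Inl i, Inr \<beta>)"] * inc by auto
      qed
    qed
    moreover have "hdegree F i \<le> card {\<alpha>\<in>F. c \<alpha> = i} + card {\<alpha>\<in>F. i \<in> \<alpha> \<and> c \<alpha> \<noteq> i}"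
      unfolding hdegree_def using fin
      by (intro order.trans[OF card_mono card_Un_le]) auto
    ultimately show "hdegree F i \<le> card {\<alpha>\<in>F. c \<alpha> = i} + 1" by linarith
  qed (rule c(1))
qed

end

section \<open>Convexity inequalities\<close>

lemma convex_on_sum_fun:
  assumes "convex S" "\<And>i. i \<in> I \<Longrightarrow> convex_on S (f i)"
  shows "convex_on S (\<lambda>x. \<Sum>i\<in>I. f i x)"
  using assms(2)
proof (induction I rule: infinite_finite_induct)
  case (insert i I)
  then show ?case using convex_on_add[of S "f i" "\<lambda>x. \<Sum>i\<in>I. f i x"] by simp
qed (use assms(1) in \<open>auto simp: convex_on_def\<close>)

lemma convex_on_eq_on:
  assumes "convex_on S f" "\<And>x. x \<in> S \<Longrightarrow> f x = g x"
  shows "convex_on S g"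
  using assms unfolding convex_on_def by (metis (full_types) convexD)

lemma convex_on_midpoint:
  assumes "convex_on S f" "x \<in> S" "y \<in> S"
  shows "f ((1/2) *\<^sub>R x + (1/2) *\<^sub>R y) \<le> 1/2 * f x + 1/2 * f y"
  using convex_onD[OF assms(1), of "1/2" x y] assms(2,3) by simp

lemma convex_on_linear: "linear l \<Longrightarrow> convex S \<Longrightarrow> convex_on S l"
  by (simp add: convex_on_def linear_add linear_scale)

text \<open>Tangent line at the ratio \<open>X / Y\<close> of the convex combinations, via \<open>ln t \<le> t - 1\<close>.\<close>

lemma mult_ln_ratio_convex:
  fixes u v x y x' y' :: real
  assumes pos: "x > 0" "y > 0" "x' > 0" "y' > 0" and uv: "u \<ge> 0" "v \<ge> 0" "u + v = 1"
  shows "(u * x + v * x') * (ln (u * x + v * x') - ln (u * y + v * y'))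
    \<le> u * (x * (ln x - ln y)) + v * (x' * (ln x' - ln y'))"
proof -
  define X Y where "X = u * x + v * x'" and "Y = u * y + v * y'"
  have XY: "X > 0" "Y > 0"
    using convexD[OF convex_real_interval(3)[of 0], of x x' u v]
      convexD[OF convex_real_interval(3)[of 0], of y y' u v] pos uv by (auto simp: X_def Y_def)
  have tangent: "a * (ln a - ln b) \<ge> a * (ln X - ln Y) + a - b * X / Y" if "a > 0" "b > 0" for a b
  proof -
    have "ln (b * X / (a * Y)) \<le> b * X / (a * Y) - 1"
      using that XY by (intro ln_le_minus_one) simp
    then have "ln b + ln X - ln a - ln Y \<le> b * X / (a * Y) - 1"
      using that XY by (simp add: ln_div ln_mult)
    then have "a * (ln b + ln X - ln a - ln Y) \<le> a * (b * X / (a * Y) - 1)"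
      using that by (intro mult_left_mono) auto
    also have "\<dots> = b * X / Y - a" using that XY by (simp add: field_simps)
    finally show ?thesis by (simp add: algebra_simps)
  qed
  \<comment> \<open>The tangent bounds are linear in \<open>(a, b)\<close>, so their weighted sum is
    the bound at \<open>(X, Y)\<close>, where it is exact.\<close>
  have "u * (x * (ln X - ln Y) + x - y * X / Y) + v * (x' * (ln X - ln Y) + x' - y' * X / Y)
      \<le> u * (x * (ln x - ln y)) + v * (x' * (ln x' - ln y'))"
    by (intro add_mono mult_left_mono tangent pos uv)
  also have "u * (x * (ln X - ln Y) + x - y * X / Y) + v * (x' * (ln X - ln Y) + x' - y' * X / Y)
      = X * (ln X - ln Y) + X - (Y * X) / Y"
    unfolding X_def Y_def by (simp add: algebra_simps add_divide_distrib diff_divide_distrib)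
  finally show ?thesis using XY by (simp add: X_def Y_def)
qed

lemma mult_ln_convex:
  fixes u v x x' :: real
  assumes "x > 0" "x' > 0" "u \<ge> 0" "v \<ge> 0" "u + v = 1"
  shows "(u * x + v * x') * ln (u * x + v * x') \<le> u * (x * ln x) + v * (x' * ln x')"
  using mult_ln_ratio_convex[of x 1 x' 1 u v] assms by simp

text \<open>Convexity of the quadratic-over-linear function:
  \<open>2 * a * r - r\<^sup>2 * b\<close> is its tangent plane along the ray of ratio
  \<open>r\<close>, and the gap is \<open>(a - r * b)\<^sup>2 / b\<close>.\<close>

lemma square_over_convex:
  fixes u v x y p q :: real
  assumes "p > 0" "q > 0" "u \<ge> 0" "v \<ge> 0" "u + v = 1"
  shows "(u * x + v * y)\<^sup>2 / (u * p + v * q) \<le> u * (x\<^sup>2 / p) + v * (y\<^sup>2 / q)"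
proof -
  define A P r where "A = u * x + v * y" and "P = u * p + v * q" and "r = A / P"
  have P: "P > 0"
    using convexD[OF convex_real_interval(3)[of 0], of p q u v] assms by (auto simp: P_def)
  have tangent: "2 * a * r - r\<^sup>2 * b \<le> a\<^sup>2 / b" if "b > 0" for a b
  proof -
    have "0 \<le> (a - r * b)\<^sup>2 / b" using that by simp
    then show ?thesis using that by (simp add: power2_diff field_simps power2_eq_square)
  qed
  have "u * (2 * x * r - r\<^sup>2 * p) + v * (2 * y * r - r\<^sup>2 * q) \<le> u * (x\<^sup>2 / p) + v * (y\<^sup>2 / q)"
    by (intro add_mono mult_left_mono tangent assms)
  also have "u * (2 * x * r - r\<^sup>2 * p) + v * (2 * y * r - r\<^sup>2 * q) = 2 * A * r - r\<^sup>2 * P"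
    by (simp add: A_def P_def algebra_simps)
  also have "\<dots> = A\<^sup>2 / P" using P by (simp add: r_def field_simps power2_eq_square)
  finally show ?thesis by (simp add: A_def P_def)
qed

text \<open>Only the end point 0 needs an argument: substituting \<open>inverse x\<close> turns the
  limit there into that of \<open>ln x / x\<close> at infinity. The value at 0 is 0 whatever
  \<open>ln 0\<close> is.\<close>

lemma continuous_on_mult_ln: "continuous_on {0..} (\<lambda>x::real. x * ln x)"
proof -
  have "((\<lambda>x::real. - (ln x / x)) \<longlongrightarrow> - 0) at_top"
    by (intro tendsto_minus ln_x_over_x_tendsto_0)
  moreover have "\<forall>\<^sub>F x::real in at_top. - (ln x / x) = inverse x * ln (inverse x)"
    using eventually_gt_at_top[of 0] by eventually_elim (simp add: ln_inverse divide_inverse)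
  ultimately have "((\<lambda>x::real. inverse x * ln (inverse x)) \<longlongrightarrow> 0) at_top"
    by (simp only: filterlim_cong[OF refl refl] minus_zero)
  then have "((\<lambda>x::real. x * ln x) \<longlongrightarrow> 0) (at_right 0)"
    by (simp add: filterlim_at_right_to_top)
  then have "continuous (at 0 within {0..}) (\<lambda>x::real. x * ln x)"
    by (simp add: continuous_within at_within_Ici_at_right)
  moreover have "continuous (at x within {0..}) (\<lambda>x::real. x * ln x)" if "x > 0" for x
    using that by (intro continuous_intros) auto
  ultimately show ?thesis
    unfolding continuous_on_eq_continuous_within by (metis atLeast_iff le_less)
qed

text \<open>Grouping the factors by chosen variable turns what they give away into multiplicities,
  which can be compared with \<open>d_i - 1\<close>.\<close>

lemma sum_over_choice:
  fixes G :: "'v \<Rightarrow> real"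
  assumes "finite V" "finite F" "\<And>\<alpha>. \<alpha> \<in> F \<Longrightarrow> c \<alpha> \<in> V"
  shows "(\<Sum>\<alpha>\<in>F. G (c \<alpha>)) = (\<Sum>i\<in>V. real (card {\<alpha>\<in>F. c \<alpha> = i}) * G i)"
proof -
  have "(\<Sum>\<alpha>\<in>F. G (c \<alpha>)) = (\<Sum>i\<in>V. \<Sum>\<alpha>\<in>{\<alpha>\<in>F. c \<alpha> = i}. G (c \<alpha>))"
    using assms by (intro sum.group[symmetric]) auto
  then show ?thesis by simp
qed

section \<open>The multinomial family\<close>

lemma finite_states: "finite (states N i)"
  by (simp add: states_def)

lemma finite_configs: "finite \<alpha> \<Longrightarrow> finite (configs N \<alpha>)"
  by (auto simp: configs_def finite_states intro: finite_PiE)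

text \<open>Positivity is relaxed to nonnegativity in order to admit deterministic beliefs, near
  which convexity is tested.\<close>

definition multinomial_closure :: "'v set \<Rightarrow> 'v set set \<Rightarrow> ('v \<Rightarrow> nat) \<Rightarrow> 'v beliefs set"
  where "multinomial_closure V F N = {(bF, bV).
    (\<forall>\<alpha>\<in>F. (\<forall>x\<in>configs N \<alpha>. bF \<alpha> x \<ge> 0) \<and> (\<Sum>x\<in>configs N \<alpha>. bF \<alpha> x) = 1) \<and>
    (\<forall>i\<in>V. (\<forall>a\<in>states N i. bV i a \<ge> 0) \<and> (\<Sum>a\<in>states N i. bV i a) = 1) \<and>
    (\<forall>\<alpha>\<in>F. \<forall>i\<in>\<alpha>. \<forall>a\<in>states N i. bV i a = (\<Sum>x\<in>{x\<in>configs N \<alpha>. x i = a}. bF \<alpha> x)) \<and>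
    (\<forall>\<alpha> x. \<not> (\<alpha> \<in> F \<and> x \<in> configs N \<alpha>) \<longrightarrow> bF \<alpha> x = 0) \<and>
    (\<forall>i a. \<not> (i \<in> V \<and> a \<in> states N i) \<longrightarrow> bV i a = 0)}"

lemma multinomial_L_subset_closure: "multinomial_L V F N \<subseteq> multinomial_closure V F N"
  by (auto simp: multinomial_L_def multinomial_closure_def pos_prob_fun_def less_imp_le)

text \<open>The equality constraints are affine, and any positive weight on a strictly positive
  point keeps all entries positive. This moves boundary points into the domain.\<close>

lemma multinomial_interior_combination:
  assumes "b \<in> multinomial_L V F N" "d \<in> multinomial_closure V F N" "u > 0" "v \<ge> 0" "u + v = 1"
  shows "u *\<^sub>R b + v *\<^sub>R d \<in> multinomial_L V F N"
proof -
  obtain bF bV dF dV where bd: "b = (bF, bV)" "d = (dF, dV)" by (metis prod.exhaust)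
  have "u * s + v * t > 0" if "s > 0" "t \<ge> 0" for s t :: real
    using that assms by (simp add: add_pos_nonneg)
  then show ?thesis
    using assms unfolding bd multinomial_L_def multinomial_closure_def pos_prob_fun_def
    by (auto simp: scaleR_fun_def plus_fun_def sum.distrib sum_distrib_left[symmetric])
qed

lemma convex_multinomial_L: "convex (multinomial_L V F N)"
proof (rule convexI)
  fix x y :: "'a beliefs" and u v :: real
  assume *: "x \<in> multinomial_L V F N" "y \<in> multinomial_L V F N" "0 \<le> u" "0 \<le> v" "u + v = 1"
  show "u *\<^sub>R x + v *\<^sub>R y \<in> multinomial_L V F N"
  proof (cases "u = 0")
    case False
    then show ?thesis
      using * multinomial_L_subset_closure by (intro multinomial_interior_combination) auto
  qed (use * in auto)
qed

section \<open>Entropy part of the free energy and sufficiency\<close>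

definition negentropy ::
  "'v set \<Rightarrow> 'v set set \<Rightarrow> ('v \<Rightarrow> nat) \<Rightarrow> 'v beliefs \<Rightarrow> real"
  where "negentropy V F N b =
      (\<Sum>\<alpha>\<in>F. \<Sum>x\<in>configs N \<alpha>. fst b \<alpha> x * ln (fst b \<alpha> x))
      + (\<Sum>i\<in>V. (1 - real (hdegree F i)) * (\<Sum>a\<in>states N i. snd b i a * ln (snd b i a)))"

definition mean_energy ::
  "'v set set \<Rightarrow> ('v \<Rightarrow> nat) \<Rightarrow> ('v set \<Rightarrow> ('v \<Rightarrow> nat) \<Rightarrow> real) \<Rightarrow> 'v beliefs \<Rightarrow> real"
  where "mean_energy F N \<Psi> b = - (\<Sum>\<alpha>\<in>F. \<Sum>x\<in>configs N \<alpha>. fst b \<alpha> x * ln (\<Psi> \<alpha> x))"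

text \<open>The potentials enter only through a linear term, so convexity does not depend on
  them.\<close>

lemma multinomial_FB_eq: "multinomial_FB V F N \<Psi> b = mean_energy F N \<Psi> b + negentropy V F N b"
  by (simp add: multinomial_FB_def negentropy_def mean_energy_def case_prod_beta)

lemma linear_mean_energy: "linear (mean_energy F N \<Psi>)"
  by (rule linearI)
    (auto simp: mean_energy_def scaleR_fun_def plus_fun_def sum.distrib sum_distrib_left algebra_simps)

text \<open>Subtracting the negative entropy of the chosen marginal makes each factor term a
  conditional negative entropy, jointly convex in the two beliefs. Adding it back at the variables
  leaves the weight \<open>k i\<close>, nonnegative by \<open>deg\<close>.\<close>

lemma convex_on_negentropy:
  assumes V: "hypergraph V F" and c: "\<And>\<alpha>. \<alpha> \<in> F \<Longrightarrow> c \<alpha> \<in> \<alpha>"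
    and deg: "\<And>i. i \<in> V \<Longrightarrow> hdegree F i \<le> card {\<alpha>\<in>F. c \<alpha> = i} + 1"
  shows "convex_on (multinomial_L V F N) (negentropy V F N)"
proof -
  let ?L = "multinomial_L V F N"
  have fin: "finite V" "finite F" "\<And>\<alpha>. \<alpha> \<in> F \<Longrightarrow> finite \<alpha>"
    using V finite_factors[OF V] by (auto simp: hypergraph_def intro: finite_subset)
  have cV: "c \<alpha> \<in> V" if "\<alpha> \<in> F" for \<alpha> using c[OF that] that V by (auto simp: hypergraph_def)
  define k where "k i = 1 + real (card {\<alpha>\<in>F. c \<alpha> = i}) - real (hdegree F i)" for i
  define f where "f b = (\<Sum>\<alpha>\<in>F. \<Sum>x\<in>configs N \<alpha>.
      fst b \<alpha> x * (ln (fst b \<alpha> x) - ln (snd b (c \<alpha>) (x (c \<alpha>)))))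
    + (\<Sum>i\<in>V. k i * (\<Sum>a\<in>states N i. snd b i a * ln (snd b i a)))" for b :: "'a beliefs"
  have pos: "fst b \<alpha> x > 0" "snd b (c \<alpha>) (x (c \<alpha>)) > 0"
    if "b \<in> ?L" "\<alpha> \<in> F" "x \<in> configs N \<alpha>" for b \<alpha> x
  proof -
    have "x (c \<alpha>) \<in> states N (c \<alpha>)" using that c[of \<alpha>] by (auto simp: configs_def)
    then show "fst b \<alpha> x > 0" "snd b (c \<alpha>) (x (c \<alpha>)) > 0"
      using that cV[of \<alpha>] by (auto simp: multinomial_L_def pos_prob_fun_def)
  qed
  have pos': "snd b i a > 0" if "b \<in> ?L" "i \<in> V" "a \<in> states N i" for b i a
    using that by (auto simp: multinomial_L_def pos_prob_fun_def)
  have "convex_on ?L (\<lambda>b. fst b \<alpha> x * (ln (fst b \<alpha> x) - ln (snd b (c \<alpha>) (x (c \<alpha>)))))"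
    if "\<alpha> \<in> F" "x \<in> configs N \<alpha>" for \<alpha> x
    unfolding convex_on_def
    using convex_multinomial_L mult_ln_ratio_convex pos that
    by (auto simp: scaleR_fun_def plus_fun_def)
  moreover have "convex_on ?L (\<lambda>b. snd b i a * ln (snd b i a))"
    if "i \<in> V" "a \<in> states N i" for i a
    unfolding convex_on_def
    using convex_multinomial_L mult_ln_convex pos' that
    by (auto simp: scaleR_fun_def plus_fun_def)
  moreover have "k i \<ge> 0" if "i \<in> V" for i
    using deg[OF that] by (simp add: k_def)
  ultimately have "convex_on ?L f"
    unfolding f_def
    by (intro convex_on_add convex_on_sum_fun convex_on_cmul convex_multinomial_L) auto
  moreover have "f b = negentropy V F N b" if b: "b \<in> ?L" for b
  proof -
    define G where "G i = (\<Sum>a\<in>states N i. snd b i a * ln (snd b i a))" for i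
    \<comment> \<open>Configurations are grouped by their value at \<open>c \<alpha>\<close>; the
      logarithm is constant on each group, and the marginal condition sums the group.\<close>
    have marg: "(\<Sum>x\<in>configs N \<alpha>. fst b \<alpha> x * ln (snd b (c \<alpha>) (x (c \<alpha>)))) = G (c \<alpha>)"
      if "\<alpha> \<in> F" for \<alpha>
    proof -
      have "(\<Sum>x\<in>configs N \<alpha>. fst b \<alpha> x * ln (snd b (c \<alpha>) (x (c \<alpha>))))
        = (\<Sum>a\<in>states N (c \<alpha>). \<Sum>x\<in>{x\<in>configs N \<alpha>. x (c \<alpha>) = a}.
            fst b \<alpha> x * ln (snd b (c \<alpha>) (x (c \<alpha>))))"
        using fin that c[OF that]
        by (intro sum.group[symmetric] finite_configs finite_states) (auto simp: configs_def)
      also have "\<dots> = (\<Sum>a\<in>states N (c \<alpha>).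
          (\<Sum>x\<in>{x\<in>configs N \<alpha>. x (c \<alpha>) = a}. fst b \<alpha> x) * ln (snd b (c \<alpha>) a))"
        by (simp add: sum_distrib_right)
      also have "\<dots> = G (c \<alpha>)"
        unfolding G_def using b that c[OF that]
        by (intro sum.cong) (auto simp: multinomial_L_def)
      finally show ?thesis .
    qed
    have "f b = (\<Sum>\<alpha>\<in>F. \<Sum>x\<in>configs N \<alpha>. fst b \<alpha> x * ln (fst b \<alpha> x)) - (\<Sum>\<alpha>\<in>F. G (c \<alpha>))
      + (\<Sum>i\<in>V. k i * G i)"
      by (simp add: f_def G_def[symmetric] marg right_diff_distrib sum_subtractf)
    also have "(\<Sum>\<alpha>\<in>F. G (c \<alpha>)) = (\<Sum>i\<in>V. real (card {\<alpha>\<in>F. c \<alpha> = i}) * G i)"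
      using fin cV by (intro sum_over_choice)
    finally show ?thesis
      by (simp add: negentropy_def G_def k_def algebra_simps sum.distrib sum_subtractf)
  qed
  ultimately show ?thesis by (rule convex_on_eq_on)
qed

section \<open>Test points and necessity\<close>

definition uniform_beliefs :: "'v set \<Rightarrow> 'v set set \<Rightarrow> ('v \<Rightarrow> nat) \<Rightarrow> 'v beliefs"
  where "uniform_beliefs V F N =
    (\<lambda>\<alpha> x. if \<alpha> \<in> F \<and> x \<in> configs N \<alpha> then 1 / real (card (configs N \<alpha>)) else 0,
     \<lambda>i a. if i \<in> V \<and> a \<in> states N i then 1 / real (N i) else 0)"

lemma uniform_beliefs_in_multinomial_L:
  assumes V: "hypergraph V F" and N: "\<And>i. i \<in> V \<Longrightarrow> N i \<ge> 1"
  shows "uniform_beliefs V F N \<in> multinomial_L V F N"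
proof -
  have fin: "finite \<alpha>" if "\<alpha> \<in> F" for \<alpha>
    using that V by (auto simp: hypergraph_def intro: finite_subset)
  have NF: "N i > 0" if "\<alpha> \<in> F" "i \<in> \<alpha>" for \<alpha> i
  proof -
    have "i \<in> V" using that V by (auto simp: hypergraph_def)
    then show ?thesis using N[of i] by simp
  qed
  have card: "card (configs N \<alpha>) = (\<Prod>i\<in>\<alpha>. N i)" if "\<alpha> \<in> F" for \<alpha>
    using fin[OF that] by (simp add: configs_def card_PiE states_def)
  have pos: "card (configs N \<alpha>) > 0" if "\<alpha> \<in> F" for \<alpha>
    unfolding card[OF that] using NF that by (simp add: prod_pos)
  have marg: "1 / real (N i) =
      real (card {x\<in>configs N \<alpha>. x i = a}) / real (card (configs N \<alpha>))"
    if "\<alpha> \<in> F" "i \<in> \<alpha>" "a \<in> states N i" for \<alpha> i a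
  proof -
    \<comment> \<open>Fixing one coordinate gives again a product set, smaller by the factor
      \<open>N i\<close>.\<close>
    have "{x\<in>configs N \<alpha>. x i = a} = (\<Pi>\<^sub>E j\<in>\<alpha>. if j = i then {a} else states N j)"
      using that by (auto simp: configs_def PiE_iff extensional_def split: if_splits)
    then have "card {x\<in>configs N \<alpha>. x i = a} = (\<Prod>j\<in>\<alpha>. card (if j = i then {a} else states N j))"
      using fin[OF that(1)] by (simp add: card_PiE)
    also have "\<dots> = (\<Prod>j\<in>\<alpha>-{i}. N j)"
      using fin[OF that(1)] that by (simp add: prod.remove[of _ i] states_def)
    finally have "card (configs N \<alpha>) = N i * card {x\<in>configs N \<alpha>. x i = a}"
      unfolding card[OF that(1)] using fin[OF that(1)] that by (simp add: prod.remove[of _ i])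
    then show ?thesis using pos[OF that(1)] NF[OF that(1,2)] by (simp add: field_simps)
  qed
  have N0: "N i \<noteq> 0" if "i \<in> V" for i using N[OF that] by simp
  show ?thesis
    using pos marg N0 V
    unfolding uniform_beliefs_def multinomial_L_def pos_prob_fun_def
    by (auto simp: states_def hypergraph_def)
qed

text \<open>All variables are in state \<open>k\<close> with probability 1. The restricted function
  matches the extensional configurations.\<close>

definition point_beliefs :: "'v set \<Rightarrow> 'v set set \<Rightarrow> nat \<Rightarrow> 'v beliefs"
  where "point_beliefs V F k =
    (\<lambda>\<alpha> x. if \<alpha> \<in> F \<and> x = (\<lambda>i\<in>\<alpha>. k) then 1 else 0, \<lambda>i a. if i \<in> V \<and> a = k then 1 else 0)"

lemma point_beliefs_in_closure:
  assumes V: "hypergraph V F" and k: "\<And>i. i \<in> V \<Longrightarrow> k \<in> states N i"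
  shows "point_beliefs V F k \<in> multinomial_closure V F N"
proof -
  have fin: "finite (configs N \<alpha>)" and k': "(\<lambda>i\<in>\<alpha>. k) \<in> configs N \<alpha>" if "\<alpha> \<in> F" for \<alpha>
    using that V k finite_configs[of \<alpha> N] finite_subset[of \<alpha> V]
    by (auto simp: hypergraph_def configs_def)
  have "(\<Sum>x\<in>{x\<in>configs N \<alpha>. x i = a}. if x = (\<lambda>i\<in>\<alpha>. k) then 1 else 0) = (if a = k then 1 else (0::real))"
    if "\<alpha> \<in> F" "i \<in> \<alpha>" for \<alpha> i a
    using fin[OF that(1)] k'[OF that(1)] that by (simp add: sum.delta')
  then show ?thesis
    using fin k' V k unfolding point_beliefs_def multinomial_closure_def
    by (auto simp: finite_states hypergraph_def)
qed

text \<open>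
  On the perfectly correlated beliefs every factor and every variable has the entropy of the same
  coin, so that the negentropy is \<open>n(H) - 1\<close> times the entropy of that coin.
\<close>

lemma negentropy_correlated_midpoint:
  assumes V: "hypergraph V F" and N: "\<And>i. i \<in> V \<Longrightarrow> N i \<ge> 2"
  shows "negentropy V F N ((1/2) *\<^sub>R point_beliefs V F 1 + (1/2) *\<^sub>R point_beliefs V F 2)
    = (real (card (directed_edges F)) - real (card V) - real (card F)) * ln 2"
proof -
  let ?M = "(1/2) *\<^sub>R point_beliefs V F 1 + (1/2) *\<^sub>R point_beliefs V F 2"
  have states: "1 \<in> states N i" "2 \<in> states N i" if "i \<in> V" for i
    using N[OF that] by (auto simp: states_def)
  have "(\<Sum>x\<in>configs N \<alpha>. fst ?M \<alpha> x * ln (fst ?M \<alpha> x)) = - ln 2" if \<alpha>: "\<alpha> \<in> F" for \<alpha>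
  proof -
    define o1 o2 where "o1 = (\<lambda>i\<in>\<alpha>. 1::nat)" and "o2 = (\<lambda>i\<in>\<alpha>. 2::nat)"
    have o: "o1 \<in> configs N \<alpha>" "o2 \<in> configs N \<alpha>" and fin: "finite (configs N \<alpha>)" and ne: "\<alpha> \<noteq> {}"
      using \<alpha> V states finite_configs[of \<alpha> N] finite_subset[of \<alpha> V]
      by (auto simp: o1_def o2_def configs_def hypergraph_def)
    \<comment> \<open>Since \<alpha> is nonempty, the two atoms of weight 1/2 stay separate, each
      contributing \<open>- ln 2 / 2\<close>.\<close>
    have ne: "o1 \<noteq> o2" using ne by (auto simp: o1_def o2_def fun_eq_iff restrict_def)
    have "fst ?M \<alpha> x * ln (fst ?M \<alpha> x) =
        (if x = o1 then - ln 2 / 2 else 0) + (if x = o2 then - ln 2 / 2 else 0)" for x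
      using \<alpha> ne unfolding point_beliefs_def o1_def o2_def
      by (simp add: scaleR_fun_def plus_fun_def ln_div)
    then show ?thesis using o fin by (simp add: sum.distrib)
  qed
  moreover have "(\<Sum>a\<in>states N i. snd ?M i a * ln (snd ?M i a)) = - ln 2" if i: "i \<in> V" for i
  proof -
    have "snd ?M i a * ln (snd ?M i a) =
        (if a = 1 then - ln 2 / 2 else 0) + (if a = 2 then - ln 2 / 2 else 0)" for a
      using i by (auto simp: point_beliefs_def scaleR_fun_def plus_fun_def ln_div)
    then show ?thesis using states[OF i] by (simp add: sum.distrib finite_states)
  qed
  ultimately have "negentropy V F N ?M = (\<Sum>\<alpha>\<in>F. - ln 2) + (\<Sum>i\<in>V. (1 - real (hdegree F i)) * - ln 2)"
    unfolding negentropy_def by (simp only: cong: sum.cong)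
  also have "\<dots> = - ln 2 * real (card F) - ln 2 * (\<Sum>i\<in>V. 1 - real (hdegree F i))"
    by (simp only: sum_distrib_right[symmetric] sum_constant) simp
  also have "\<dots> = (real (card (directed_edges F)) - real (card V) - real (card F)) * ln 2"
    by (simp add: card_directed_edges_eq_sum_hdegree[OF V] sum_subtractf algebra_simps)
  finally show ?thesis .
qed

text \<open>All entries are 0 or 1, where \<open>x * ln x\<close> vanishes.\<close>

lemma negentropy_point_beliefs: "negentropy V F N (point_beliefs V F k) = 0"
proof -
  have "(if P then 1 else 0) * ln (if P then 1 else 0) = (0::real)" for P by simp
  then show ?thesis
    unfolding negentropy_def point_beliefs_def fst_conv snd_conv by (simp only: sum.neutral_const mult_zero_right add_0)
qed

lemma tendsto_negentropy:
  assumes u: "u \<in> multinomial_closure V F N" and d: "d \<in> multinomial_closure V F N"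
  shows "((\<lambda>\<epsilon>. negentropy V F N (\<epsilon> *\<^sub>R u + (1 - \<epsilon>) *\<^sub>R d)) \<longlongrightarrow> negentropy V F N d) (at_right 0)"
proof -
  have *: "((\<lambda>\<epsilon>. (\<epsilon> * s + (1 - \<epsilon>) * t) * ln (\<epsilon> * s + (1 - \<epsilon>) * t)) \<longlongrightarrow> t * ln t) (at_right 0)"
    if "s \<ge> 0" "t \<ge> 0" for s t :: real
  proof (rule continuous_on_tendsto_compose[OF continuous_on_mult_ln])
    show "((\<lambda>\<epsilon>. \<epsilon> * s + (1 - \<epsilon>) * t) \<longlongrightarrow> t) (at_right 0)"
      by (auto intro!: tendsto_eq_intros)
    have "\<forall>\<^sub>F \<epsilon> in at_right (0::real). \<epsilon> \<in> {0<..<1}"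
      by (rule eventually_at_rightI[of 0 1]) auto
    then show "\<forall>\<^sub>F \<epsilon> in at_right 0. \<epsilon> * s + (1 - \<epsilon>) * t \<in> {0..}"
      by eventually_elim (use that in auto)
  qed (use that in auto)
  have nn: "fst b \<alpha> x \<ge> 0" if "b \<in> multinomial_closure V F N" "\<alpha> \<in> F" "x \<in> configs N \<alpha>" for b \<alpha> x
    using that by (auto simp: multinomial_closure_def)
  have nn': "snd b i a \<ge> 0" if "b \<in> multinomial_closure V F N" "i \<in> V" "a \<in> states N i" for b i a
    using that by (auto simp: multinomial_closure_def)
  show ?thesis
    unfolding negentropy_def fst_add snd_add fst_scaleR snd_scaleR scaleR_fun_def plus_fun_def real_scaleR_def
    by (intro tendsto_add tendsto_sum tendsto_mult[OF tendsto_const] *)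
      (simp_all add: nn[OF u] nn[OF d] nn'[OF u] nn'[OF d])
qed

text \<open>Two deterministic beliefs and their midpoint lie outside the domain, so a share
  \<epsilon> of the uniform beliefs is mixed in. The midpoint inequality survives \<epsilon>
  \<rightarrow> 0 and forces the coefficient of \<open>ln 2\<close> to be at most 0.\<close>

lemma convex_on_negentropy_imp:
  assumes V: "hypergraph V F" and N: "\<And>i. i \<in> V \<Longrightarrow> N i \<ge> 2"
    and conv: "convex_on (multinomial_L V F N) (negentropy V F N)"
  shows "card (directed_edges F) \<le> card V + card F"
proof -
  let ?L = "multinomial_L V F N" and ?K = "multinomial_closure V F N" and ?\<phi> = "negentropy V F N"
  define d1 d2 u where "d1 = point_beliefs V F 1" and "d2 = point_beliefs V F 2"
    and "u = uniform_beliefs V F N"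
  define m where "m = (1/2) *\<^sub>R d1 + (1/2) *\<^sub>R d2"
  have d: "d1 \<in> ?K" "d2 \<in> ?K"
    using N by (auto simp: d1_def d2_def states_def intro!: point_beliefs_in_closure[OF V])
      force
  have u: "u \<in> ?L"
    using N unfolding u_def by (intro uniform_beliefs_in_multinomial_L[OF V]) force
  then have uK: "u \<in> ?K" using multinomial_L_subset_closure by blast
  have m: "m \<in> ?K"
    using d unfolding m_def multinomial_closure_def
    by (auto simp: scaleR_fun_def plus_fun_def sum.distrib sum_divide_distrib[symmetric]
      simp flip: add_divide_distrib)
  have "\<forall>\<^sub>F \<epsilon> in at_right (0::real). \<epsilon> \<in> {0<..<1}"
    by (rule eventually_at_rightI[of 0 1]) auto
  then have "\<forall>\<^sub>F \<epsilon> in at_right (0::real). ?\<phi> (\<epsilon> *\<^sub>R u + (1 - \<epsilon>) *\<^sub>R m)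
    \<le> 1/2 * ?\<phi> (\<epsilon> *\<^sub>R u + (1 - \<epsilon>) *\<^sub>R d1) + 1/2 * ?\<phi> (\<epsilon> *\<^sub>R u + (1 - \<epsilon>) *\<^sub>R d2)"
  proof eventually_elim
    case (elim \<epsilon>)
    let ?p = "\<lambda>d. \<epsilon> *\<^sub>R u + (1 - \<epsilon>) *\<^sub>R d"
    have "?p d1 \<in> ?L" "?p d2 \<in> ?L"
      using elim u d by (auto intro: multinomial_interior_combination)
    then have "?\<phi> ((1/2) *\<^sub>R ?p d1 + (1/2) *\<^sub>R ?p d2) \<le> 1/2 * ?\<phi> (?p d1) + 1/2 * ?\<phi> (?p d2)"
      by (rule convex_on_midpoint[OF conv])
    moreover have "(1/2) *\<^sub>R ?p d1 + (1/2) *\<^sub>R ?p d2 = ?p m"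
    proof -
      have "?p m = (1/2 + 1/2) *\<^sub>R \<epsilon> *\<^sub>R u + (1 - \<epsilon>) *\<^sub>R m" by simp
      then show ?thesis
        unfolding m_def scaleR_add_left scaleR_add_right by (simp add: ac_simps)
    qed
    ultimately show ?case by simp
  qed
  moreover have "((\<lambda>\<epsilon>. 1/2 * ?\<phi> (\<epsilon> *\<^sub>R u + (1 - \<epsilon>) *\<^sub>R d1) + 1/2 * ?\<phi> (\<epsilon> *\<^sub>R u + (1 - \<epsilon>) *\<^sub>R d2))
      \<longlongrightarrow> 1/2 * ?\<phi> d1 + 1/2 * ?\<phi> d2) (at_right 0)"
    by (intro tendsto_intros tendsto_negentropy uK d)
  ultimately have "?\<phi> m \<le> 1/2 * ?\<phi> d1 + 1/2 * ?\<phi> d2"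
    using tendsto_negentropy[OF uK m] by (intro tendsto_le[OF trivial_limit_at_right_real])
  then have "(real (card (directed_edges F)) - real (card V) - real (card F)) * ln 2 \<le> 0"
    using negentropy_correlated_midpoint[of V F N] V N
    by (simp add: m_def d1_def d2_def negentropy_point_beliefs)
  then show ?thesis by (simp add: mult_le_0_iff)
qed

lemma convex_on_multinomial_FB_iff:
  "convex_on (multinomial_L V F N) (multinomial_FB V F N \<Psi>)
    \<longleftrightarrow> convex_on (multinomial_L V F N) (negentropy V F N)"
proof -
  let ?L = "multinomial_L V F N" and ?e = "mean_energy F N \<Psi>"
  have e: "convex_on ?L ?e" "convex_on ?L (\<lambda>b. - ?e b)"
    using linear_mean_energy convex_multinomial_L
    by (auto intro!: convex_on_linear linear_compose_neg)
  have "multinomial_FB V F N \<Psi> = (\<lambda>b. ?e b + negentropy V F N b)"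
    using multinomial_FB_eq by blast
  moreover have "negentropy V F N = (\<lambda>b. - ?e b + multinomial_FB V F N \<Psi> b)"
    by (simp add: multinomial_FB_eq)
  ultimately show ?thesis
    using convex_on_add[OF e(1), of "negentropy V F N"]
      convex_on_add[OF e(2), of "multinomial_FB V F N \<Psi>"] by metis
qed

section \<open>The fixed-mean Gaussian family\<close>

lemma simple_graph_edgeE:
  assumes "simple_graph V E" "e \<in> E" "i \<in> e"
  obtains j where "e = {i, j}" "j \<noteq> i" "i \<in> V" "j \<in> V"
proof -
  have "card e = 2" "e \<subseteq> V" using assms by (auto simp: simple_graph_def hypergraph_def)
  then obtain j where "e = {i, j}" "j \<noteq> i"
    using assms(3) by (auto simp: card_2_iff)
  with \<open>e \<subseteq> V\<close> show thesis using that by auto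
qed

text \<open>For \<open>e = {i, j}\<close> with \<open>c e = i\<close> this is \<eta>_jj -
  \<eta>_ij^2 / \<eta>_ii, the conditional variance of \<open>j\<close> given \<open>i\<close>. The
  product over a singleton avoids naming the other end.\<close>

definition schur :: "('v set \<Rightarrow> 'v) \<Rightarrow> 'v set \<Rightarrow> 'v moments \<Rightarrow> real"
  where "schur c e \<eta> = (\<Prod>j\<in>e - {c e}. fst \<eta> j) - (snd \<eta> e)\<^sup>2 / fst \<eta> (c e)"

lemma edge_det_eq_schur:
  assumes "simple_graph V E" "e \<in> E" "c e \<in> e" "fst \<eta> (c e) > 0"
  shows "edge_det \<eta> e = fst \<eta> (c e) * schur c e \<eta>"
proof -
  obtain j where "e = {c e, j}" "j \<noteq> c e" using simple_graph_edgeE assms(1-3) by metis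
  then have "finite e" by (metis finite.emptyI finite_insert)
  then have "(\<Prod>i\<in>e. fst \<eta> i) = fst \<eta> (c e) * (\<Prod>j\<in>e - {c e}. fst \<eta> j)"
    using assms(3) by (rule prod.remove)
  then show ?thesis
    using assms(4) by (simp add: edge_det_def schur_def field_simps)
qed

text \<open>A linear function minus a quadratic-over-linear one.\<close>

lemma schur_concave:
  assumes "simple_graph V E" "e \<in> E" "c e \<in> e" "fst x (c e) > 0" "fst y (c e) > 0"
    and "u \<ge> 0" "v \<ge> 0" "u + v = 1"
  shows "u * schur c e x + v * schur c e y \<le> schur c e (u *\<^sub>R x + v *\<^sub>R y)"
proof -
  obtain j where j: "e = {c e, j}" "j \<noteq> c e" using simple_graph_edgeE assms(1-3) by metis
  then have e: "e - {c e} = {j}" by (metis Diff_insert_absorb insert_commute singletonD)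
  show ?thesis
    using square_over_convex[OF assms(4-8), of "snd x e" "snd y e"]
    unfolding schur_def e by (simp add: scaleR_fun_def plus_fun_def algebra_simps)
qed

lemma gaussian_LD:
  assumes "\<eta> \<in> gaussian_L V E"
  shows "i \<in> V \<Longrightarrow> fst \<eta> i > 0" "e \<in> E \<Longrightarrow> edge_det \<eta> e > 0"
  using assms by (auto simp: gaussian_L_def)

context
  fixes V :: "'v set" and E c
  assumes G: "simple_graph V E" and c: "\<And>e. e \<in> E \<Longrightarrow> c e \<in> e"
begin

private lemma choice_vertex: "e \<in> E \<Longrightarrow> c e \<in> V"
  using G c by (auto simp: simple_graph_def hypergraph_def)

private lemma schur_pos:
  assumes "\<eta> \<in> gaussian_L V E" "e \<in> E"
  shows "schur c e \<eta> > 0"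
  using edge_det_eq_schur[of V E e c \<eta>, OF G assms(2) c[OF assms(2)]]
    gaussian_LD[OF assms(1)] choice_vertex assms(2)
  by (metis zero_less_mult_pos)

text \<open>The determinant itself is not concave, but for a positive pivot its sign is that of the
  Schur complement, which is.\<close>

lemma convex_gaussian_L_choice: "convex (gaussian_L V E)"
proof (rule convexI)
  fix x y :: "'v moments" and u v :: real
  assume x: "x \<in> gaussian_L V E" and y: "y \<in> gaussian_L V E" and uv: "0 \<le> u" "0 \<le> v" "u + v = 1"
  let ?z = "u *\<^sub>R x + v *\<^sub>R y"
  have combine: "u * s + v * t > 0" if "s > 0" "t > 0" for s t :: real
    using convexD[OF convex_real_interval(3)[of 0], of s t u v] that uv by simp
  have pos: "fst ?z i > 0" if "i \<in> V" for i
    using combine gaussian_LD(1)[OF x that] gaussian_LD(1)[OF y that]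
    by (simp add: scaleR_fun_def plus_fun_def)
  have "edge_det ?z e > 0" if e: "e \<in> E" for e
  proof -
    have "0 < u * schur c e x + v * schur c e y"
      using combine schur_pos x y e by blast
    also have "\<dots> \<le> schur c e ?z"
      using schur_concave[where c = c, OF G e c[OF e] gaussian_LD(1)[OF x choice_vertex[OF e]]
          gaussian_LD(1)[OF y choice_vertex[OF e]] uv] .
    finally show ?thesis
      using edge_det_eq_schur[where c = c, OF G e c[OF e], of ?z] pos choice_vertex[OF e] by simp
  qed
  with pos x y show "?z \<in> gaussian_L V E"
    by (auto simp: gaussian_L_def scaleR_fun_def plus_fun_def)
qed

text \<open>The logarithm of each determinant splits into those of the pivot and of the Schur
  complement. The pivots, collected by variable, turn the weight \<open>1 - d_i\<close> into
  \<open>k i\<close>, which is nonnegative; \<open>- ln\<close> of a positive concave function is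
  convex.\<close>

lemma convex_on_gaussian_FB:
  assumes deg: "\<And>i. i \<in> V \<Longrightarrow> hdegree E i \<le> card {e\<in>E. c e = i} + 1" and l: "linear l"
  shows "convex_on (gaussian_L V E) (gaussian_FB V E l C)"
proof -
  let ?L = "gaussian_L V E"
  have fin: "finite V" "finite E"
    using G finite_factors by (auto simp: simple_graph_def hypergraph_def)
  define k where "k i = 1 + real (card {e\<in>E. c e = i}) - real (hdegree E i)" for i
  define f where "f \<eta> = l \<eta> + (\<Sum>e\<in>E. 1/2 * - ln (schur c e \<eta>))
    + (\<Sum>i\<in>V. (1/2 * k i) * - ln (fst \<eta> i)) + C" for \<eta> :: "'v moments"
  have ln: "- ln (u * s + v * t) \<le> u * - ln s + v * - ln t"
    if "s > 0" "t > 0" "u \<ge> 0" "v \<ge> 0" "u + v = 1" for s t u v :: real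
    using ln_concave that unfolding concave_on_def convex_on_def by simp
  have "convex_on ?L (\<lambda>\<eta>. - ln (schur c e \<eta>))" if e: "e \<in> E" for e
    unfolding convex_on_def
  proof (intro conjI ballI allI impI convex_gaussian_L_choice)
    fix x y :: "'v moments" and u v :: real
    assume x: "x \<in> ?L" and y: "y \<in> ?L" and uv: "0 \<le> u" "0 \<le> v" "u + v = 1"
    have "0 < u * schur c e x + v * schur c e y"
      using convexD[OF convex_real_interval(3)[of 0], of "schur c e x" "schur c e y" u v]
        schur_pos x y e uv by simp
    moreover have "u * schur c e x + v * schur c e y \<le> schur c e (u *\<^sub>R x + v *\<^sub>R y)"
      using schur_concave[where c = c, OF G e c[OF e] gaussian_LD(1)[OF x choice_vertex[OF e]]
          gaussian_LD(1)[OF y choice_vertex[OF e]] uv] .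
    ultimately have "- ln (schur c e (u *\<^sub>R x + v *\<^sub>R y)) \<le> - ln (u * schur c e x + v * schur c e y)"
      by simp
    also have "\<dots> \<le> u * - ln (schur c e x) + v * - ln (schur c e y)"
      using ln schur_pos x y e uv by blast
    finally show "- ln (schur c e (u *\<^sub>R x + v *\<^sub>R y)) \<le> u * - ln (schur c e x) + v * - ln (schur c e y)" .
  qed
  moreover have "convex_on ?L (\<lambda>\<eta>. - ln (fst \<eta> i))" if "i \<in> V" for i
    unfolding convex_on_def
    using convex_gaussian_L_choice ln[OF gaussian_LD(1)[OF _ that] gaussian_LD(1)[OF _ that]]
    by (simp add: scaleR_fun_def plus_fun_def)
  moreover have "k i \<ge> 0" if "i \<in> V" for i
    using deg[OF that] by (simp add: k_def)
  moreover have "convex_on ?L (\<lambda>_. C)"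
    using convex_gaussian_L_choice by (simp add: convex_on_def flip: distrib_right)
  moreover have "convex_on ?L l" using l convex_gaussian_L_choice by (rule convex_on_linear)
  ultimately have "convex_on ?L f"
    unfolding f_def
    by (intro convex_on_add convex_on_sum_fun convex_on_cmul convex_gaussian_L_choice) auto
  moreover have "f \<eta> = gaussian_FB V E l C \<eta>" if \<eta>: "\<eta> \<in> ?L" for \<eta>
  proof -
    define G' where "G' i = ln (fst \<eta> i)" for i
    have "(\<Sum>e\<in>E. ln (edge_det \<eta> e)) = (\<Sum>e\<in>E. G' (c e) + ln (schur c e \<eta>))"
    proof (rule sum.cong)
      fix e assume e: "e \<in> E"
      have "fst \<eta> (c e) > 0" using gaussian_LD(1)[OF \<eta> choice_vertex[OF e]] .
      then show "ln (edge_det \<eta> e) = G' (c e) + ln (schur c e \<eta>)"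
        using edge_det_eq_schur[where c = c and \<eta> = \<eta>, OF G e c[OF e]] schur_pos[OF \<eta> e]
        by (simp add: ln_mult_pos G'_def)
    qed simp
    also have "\<dots> = (\<Sum>i\<in>V. real (card {e\<in>E. c e = i}) * G' i) + (\<Sum>e\<in>E. ln (schur c e \<eta>))"
      using sum_over_choice[where c = c and G = G', OF fin choice_vertex] by (simp add: sum.distrib)
    finally have "(\<Sum>e\<in>E. ln (edge_det \<eta> e)) =
      (\<Sum>i\<in>V. real (card {e\<in>E. c e = i}) * G' i) + (\<Sum>e\<in>E. ln (schur c e \<eta>))" .
    then show ?thesis
      by (simp add: f_def gaussian_FB_def k_def G'_def[symmetric] algebra_simps sum.distrib
          sum_subtractf sum_negf sum_distrib_left sum_divide_distrib add_divide_distrib diff_divide_distrib)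
  qed
  ultimately show ?thesis by (rule convex_on_eq_on)
qed

end

text \<open>
  Along \<open>\<eta>\<^sub>i\<^sub>i = t\<close>, \<open>\<eta>\<^sub>i\<^sub>j = t - s\<close> the free energy tends for \<open>s \<rightarrow> 0\<close>, up to affine terms, to
  \<open>(n(H) - 1) / 2 * ln t\<close>; the midpoint inequality is tested at \<open>t = 1, 2, 3\<close>.
\<close>

lemma convex_on_gaussian_FB_imp:
  assumes G: "simple_graph V E" and l: "linear l"
    and conv: "convex_on (gaussian_L V E) (gaussian_FB V E l C)"
  shows "card E \<le> card V"
proof -
  define \<eta> :: "real \<Rightarrow> real \<Rightarrow> 'a moments" where
    "\<eta> s t = (\<lambda>i. if i \<in> V then t else 0, \<lambda>e. if e \<in> E then t - s else 0)" for s t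
  have H: "hypergraph V E" using G by (simp add: simple_graph_def)
  have det: "edge_det (\<eta> s t) e = s * (2 * t - s)" if e: "e \<in> E" for s t e
  proof -
    have "(\<Prod>i\<in>e. fst (\<eta> s t) i) = (\<Prod>i\<in>e. t)"
      using e H by (intro prod.cong) (auto simp: \<eta>_def hypergraph_def)
    moreover have "card e = 2" using G e by (simp add: simple_graph_def)
    ultimately show ?thesis
      using e by (simp add: edge_det_def \<eta>_def power2_eq_square algebra_simps)
  qed
  have "(\<Sum>i\<in>V. 1 - real (hdegree E i)) = real (card V) - real (card (directed_edges E))"
    by (simp add: card_directed_edges_eq_sum_hdegree[OF H] sum_subtractf)
  also have "card (directed_edges E) = 2 * card E"
    using G by (simp add: card_directed_edges_eq_sum_card[OF H] simple_graph_def)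
  finally have deg: "(\<Sum>i\<in>V. 1 - real (hdegree E i)) = real (card V) - 2 * real (card E)" by simp
  have FB: "gaussian_FB V E l C (\<eta> s t) = l (\<eta> s t) - 1/2 * real (card E) * (ln s + ln (2 * t - s))
      - 1/2 * (real (card V) - 2 * real (card E)) * ln t + C" if "0 < s" "s < 2 * t" for s t
  proof -
    have "(\<Sum>e\<in>E. ln (edge_det (\<eta> s t) e)) = real (card E) * (ln s + ln (2 * t - s))"
      using that by (simp add: det ln_mult_pos)
    moreover have "(\<Sum>i\<in>V. (1 - real (hdegree E i)) * ln (fst (\<eta> s t) i))
        = (real (card V) - 2 * real (card E)) * ln t"
      unfolding deg[symmetric] by (simp add: \<eta>_def sum_distrib_right)
    ultimately show ?thesis by (simp add: gaussian_FB_def)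
  qed
  have in_L: "\<eta> s t \<in> gaussian_L V E" if "0 < s" "s < 2 * t" for s t
    using that det[of _ s t] by (auto simp: gaussian_L_def \<eta>_def)
  \<comment> \<open>\<open>g s + K\<close> is twice the violation of the midpoint inequality. The
    divergent \<open>ln s\<close> has the same coefficient at all three points and cancels, as do
    \<open>l\<close> and \<open>C\<close>.\<close>
  define g where "g s = real (card E) * (ln (2 - s) / 2 + ln (6 - s) / 2 - ln (4 - s))" for s :: real
  define K where "K = (real (card V) - 2 * real (card E)) * (ln 3 / 2 - ln 2)"
  have le: "g s + K \<le> 0" if s: "0 < s" "s < 1" for s
  proof -
    have mid: "(1/2) *\<^sub>R \<eta> s 1 + (1/2) *\<^sub>R \<eta> s 3 = \<eta> s 2"
      by (auto simp: \<eta>_def scaleR_fun_def plus_fun_def fun_eq_iff field_simps)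
    have "gaussian_FB V E l C ((1/2) *\<^sub>R \<eta> s 1 + (1/2) *\<^sub>R \<eta> s 3)
        \<le> 1/2 * gaussian_FB V E l C (\<eta> s 1) + 1/2 * gaussian_FB V E l C (\<eta> s 3)"
      using s by (intro convex_on_midpoint[OF conv] in_L) auto
    moreover have "l (\<eta> s 2) = 1/2 * l (\<eta> s 1) + 1/2 * l (\<eta> s 3)"
      unfolding mid[symmetric] using l by (simp add: linear_add linear_scale)
    ultimately show ?thesis
      using s unfolding mid by (simp add: FB g_def K_def algebra_simps)
  qed
  have "(g \<longlongrightarrow> real (card E) * (ln 2 / 2 + ln 6 / 2 - ln 4)) (at_right 0)"
    unfolding g_def by (auto intro!: tendsto_eq_intros)
  then have "((\<lambda>s. g s + K) \<longlongrightarrow> real (card E) * (ln 2 / 2 + ln 6 / 2 - ln 4) + K) (at_right 0)"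
    by (intro tendsto_intros)
  moreover have "\<forall>\<^sub>F s in at_right 0. g s + K \<le> 0"
    using le by (intro eventually_at_rightI[of 0 1]) auto
  ultimately have limit: "real (card E) * (ln 2 / 2 + ln 6 / 2 - ln 4) + K \<le> 0"
    by (intro tendsto_upperbound[OF _ _ trivial_limit_at_right_real])
  have ln: "ln (6::real) = ln 2 + ln 3" "ln (4::real) = 2 * ln 2"
    using ln_mult_pos[of 2 "3::real"] ln_mult_pos[of 2 "2::real"] by simp_all
  \<comment> \<open>Both parts are multiples of \<open>ln 3 / 2 - ln 2\<close>, with coefficients
    adding up to \<open>card V - card E\<close>; the sign follows from
    \<open>ln 3 < ln 4\<close>.\<close>
  have "2 * (real (card E) * (ln 2 / 2 + ln 6 / 2 - ln 4) + K)
      = (real (card E) - real (card V)) * (2 * ln 2 - ln 3)"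
    unfolding ln K_def by (simp add: field_simps)
  with limit have "(real (card E) - real (card V)) * (2 * ln 2 - ln 3) \<le> 0"
    by (metis mult_nonneg_nonpos zero_le_numeral)
  moreover have "2 * ln 2 - ln 3 > (0::real)"
    using ln_less_cancel_iff[of 3 "4::real"] \<open>ln (4::real) = 2 * ln 2\<close> by linarith
  ultimately show ?thesis by (simp add: mult_le_0_iff)
qed

theorem theorem4p10:
  fixes V :: "'v set" and F :: "'v set set"
  assumes "hypergraph V F" and "hconnected V F"
  shows "(\<forall>N \<Psi>. multinomial_data V F N \<Psi> \<longrightarrow>
            (convex_on (multinomial_L V F N) (multinomial_FB V F N \<Psi>)
              \<longleftrightarrow> nullity V F = 0 \<or> nullity V F = 1))
       \<and> (\<forall>(l :: 'v moments \<Rightarrow> real) c. simple_graph V F \<and> linear l \<longrightarrow>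
            (convex_on (gaussian_L V F) (gaussian_FB V F l c)
              \<longleftrightarrow> nullity V F = 0 \<or> nullity V F = 1))"
proof -
  note H = assms
  have le1: "nullity V F = 0 \<or> nullity V F = 1 \<longleftrightarrow> nullity V F \<le> 1"
    using nullity_nonneg[OF H] by linarith
  \<comment> \<open>In this form the bound compares directly with both necessity results; for a
    graph there are twice as many directed edges as edges.\<close>
  have nullity: "nullity V F \<le> 1 \<longleftrightarrow> card (directed_edges F) \<le> card V + card F"
    using nullity_connected[OF H(2)] by linarith
  have "convex_on (multinomial_L V F N) (multinomial_FB V F N \<Psi>) \<longleftrightarrow> nullity V F \<le> 1"
    if "multinomial_data V F N \<Psi>" for N \<Psi>
  proof -
    have N: "N i \<ge> 2" if "i \<in> V" for i
      using that \<open>multinomial_data V F N \<Psi>\<close> by (simp add: multinomial_data_def)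
    show ?thesis
    proof
      assume "convex_on (multinomial_L V F N) (multinomial_FB V F N \<Psi>)"
      then show "nullity V F \<le> 1"
        unfolding nullity convex_on_multinomial_FB_iff
        using convex_on_negentropy_imp[of V F N] H(1) N by blast
    next
      assume "nullity V F \<le> 1"
      then obtain c where "\<And>\<alpha>. \<alpha> \<in> F \<Longrightarrow> c \<alpha> \<in> \<alpha>"
        "\<And>i. i \<in> V \<Longrightarrow> hdegree F i \<le> card {\<alpha>\<in>F. c \<alpha> = i} + 1"
        using factor_choice[OF H] by metis
      then show "convex_on (multinomial_L V F N) (multinomial_FB V F N \<Psi>)"
        unfolding convex_on_multinomial_FB_iff by (rule convex_on_negentropy[OF H(1)])
    qed
  qed
  moreover have "convex_on (gaussian_L V F) (gaussian_FB V F l C) \<longleftrightarrow> nullity V F \<le> 1"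
    if G: "simple_graph V F" and l: "linear l" for l :: "'v moments \<Rightarrow> real" and C
  proof
    assume "convex_on (gaussian_L V F) (gaussian_FB V F l C)"
    moreover have "card (directed_edges F) = 2 * card F"
      using G by (simp add: card_directed_edges_eq_sum_card[OF H(1)] simple_graph_def)
    ultimately show "nullity V F \<le> 1"
      using convex_on_gaussian_FB_imp[OF G l] unfolding nullity by fastforce
  next
    assume "nullity V F \<le> 1"
    then obtain c where "\<And>\<alpha>. \<alpha> \<in> F \<Longrightarrow> c \<alpha> \<in> \<alpha>"
      "\<And>i. i \<in> V \<Longrightarrow> hdegree F i \<le> card {\<alpha>\<in>F. c \<alpha> = i} + 1"
      using factor_choice[OF H] by metis
    then show "convex_on (gaussian_L V F) (gaussian_FB V F l C)"
      using convex_on_gaussian_FB[OF G _ _ l] by blast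
  qed
  ultimately show ?thesis unfolding le1 by blast
qed

end
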